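(* The lifted Hamming code $H_2'=\{0000,0001,1111,1110\}$ is an optimal design on the cube graph $Q_4$, and no optimal design on $Q_4$ is a stable set.
   Context: $Q_4$ is the graph with vertex set $\{0,1\}^4$ in which two vertices are adjacent iff they differ in exactly one coordinate. A stable set is a set of pairwise non-adjacent vertices. For a connected graph $G=(V,E)$ with adjacency matrix $A$ and diagonal degree matrix $D$, $L=AD^{-1}-I$. A nonempty $W\subset V$ integrates $\phi:V\to\mathbb{R}$ if $\frac{1}{|W|}\sum_{w\in W}\phi(w)=\frac{1}{|V|}\sum_{v\in V}\phi(v)$, and integrates an eigenspace of $L$ if it integrates every eigenvector in a basis of it. A frequency ordering of a regular graph lists its distinct eigenspaces of $L$ in order of nonincreasing $|\lambda+1|$ ($\lambda$ the eigenvalue), with the eigenspace of eigenvalue $0$ first; eigenspaces with equal $|\lambda+1|$ are otherwise interchangeable. The efficacy of $W$ is the minimum, over all frequency orderings and all $k$ such that $W$ integrates the first $k$ eigenspaces, of $|W|$ divided by the sum of the dimensions of these first $k$ eigenspaces. $W$ is an optimal design if its efficacy is minimal among all nonempty subsets of $V$. *)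

theory Defs
  imports "HOL-Analysis.Analysis"
begin

text \<open>
  A finite graph is given by its adjacency relation \<open>E\<close> on a finite type of vertices, so
  that the vertex set is \<open>UNIV\<close>, functions on the vertices are elements of \<open>real ^ 'v\<close>, and
  square matrices have type \<open>real ^ 'v ^ 'v\<close>.
\<close>

definition adjacency_matrix :: "('v::finite \<Rightarrow> 'v \<Rightarrow> bool) \<Rightarrow> real ^ 'v ^ 'v" where
  "adjacency_matrix E = (\<chi> u v. if E u v then 1 else 0)"

definition degree_matrix :: "('v::finite \<Rightarrow> 'v \<Rightarrow> bool) \<Rightarrow> real ^ 'v ^ 'v" where
  "degree_matrix E = (\<chi> u v. if u = v then real (card {w. E u w}) else 0)"

definition laplacian :: "('v::finite \<Rightarrow> 'v \<Rightarrow> bool) \<Rightarrow> real ^ 'v ^ 'v" where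
  "laplacian E = adjacency_matrix E ** matrix_inv (degree_matrix E) - mat 1"

definition eigenspace :: "('v::finite \<Rightarrow> 'v \<Rightarrow> bool) \<Rightarrow> real \<Rightarrow> (real ^ 'v) set" where
  "eigenspace E \<mu> = {\<phi>. laplacian E *v \<phi> = \<mu> *\<^sub>R \<phi>}"

text \<open>
  Only real eigenvalues are considered; for a regular graph the matrix \<open>laplacian E\<close> is
  symmetric, so these are all of them.
\<close>

definition eigenvalues :: "('v::finite \<Rightarrow> 'v \<Rightarrow> bool) \<Rightarrow> real set" where
  "eigenvalues E = {\<mu>. \<exists>\<phi>. \<phi> \<noteq> 0 \<and> laplacian E *v \<phi> = \<mu> *\<^sub>R \<phi>}"

definition integrates :: "'v::finite set \<Rightarrow> real ^ 'v \<Rightarrow> bool" where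
  "integrates W \<phi> \<longleftrightarrow>
     (\<Sum>w\<in>W. \<phi> $ w) / real (card W) = (\<Sum>v\<in>UNIV. \<phi> $ v) / real CARD('v)"

definition integrates_space :: "'v::finite set \<Rightarrow> (real ^ 'v) set \<Rightarrow> bool" where
  "integrates_space W \<Lambda> \<longleftrightarrow>
     (\<exists>B. independent B \<and> span B = \<Lambda> \<and> (\<forall>\<phi>\<in>B. integrates W \<phi>))"

definition frequency_ordering ::
  "('v::finite \<Rightarrow> 'v \<Rightarrow> bool) \<Rightarrow> (real ^ 'v) set list \<Rightarrow> bool" where
  "frequency_ordering E \<Lambda>s \<longleftrightarrow>
     (\<exists>ls. distinct ls \<and> set ls = eigenvalues E \<and>
           ls \<noteq> [] \<and> hd ls = 0 \<and>
           sorted_wrt (\<lambda>a b. \<bar>a + 1\<bar> \<ge> \<bar>b + 1\<bar>) ls \<and>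
           \<Lambda>s = map (eigenspace E) ls)"

text \<open>
  The number \<open>k\<close> of integrated eigenspaces is at least 1, since for \<open>k = 0\<close> the quotient
  has denominator zero. There are only finitely many frequency orderings, so the minimum
  is taken over a finite set.
\<close>

definition efficacy :: "('v::finite \<Rightarrow> 'v \<Rightarrow> bool) \<Rightarrow> 'v set \<Rightarrow> real" where
  "efficacy E W =
     Min {real (card W) / real (\<Sum>\<Lambda>\<leftarrow>take k \<Lambda>s. dim \<Lambda>) | \<Lambda>s k.
            frequency_ordering E \<Lambda>s \<and> 1 \<le> k \<and> k \<le> length \<Lambda>s \<and>
            (\<forall>\<Lambda>\<in>set (take k \<Lambda>s). integrates_space W \<Lambda>)}"

definition optimal_design :: "('v::finite \<Rightarrow> 'v \<Rightarrow> bool) \<Rightarrow> 'v set \<Rightarrow> bool" where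
  "optimal_design E W \<longleftrightarrow> W \<noteq> {} \<and> (\<forall>U. U \<noteq> {} \<longrightarrow> efficacy E W \<le> efficacy E U)"

definition stable_set :: "('v \<Rightarrow> 'v \<Rightarrow> bool) \<Rightarrow> 'v set \<Rightarrow> bool" where
  "stable_set E W \<longleftrightarrow> pairwise (\<lambda>u v. \<not> E u v) W"

text \<open>
  The entries of a vertex lie in the two-element numeral type \<open>2\<close>, whose elements are
  \<open>0\<close> and \<open>1\<close>, so \<open>2 ^ 4\<close> is the type of the vertices of the 4-dimensional cube.
\<close>

definition cube_graph :: "2 ^ 'n::finite \<Rightarrow> 2 ^ 'n \<Rightarrow> bool" where
  "cube_graph x y \<longleftrightarrow> card {i. x $ i \<noteq> y $ i} = 1"

definition lifted_hamming :: "(2 ^ 4) set" where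
  "lifted_hamming =
     {vector [0, 0, 0, 0], vector [0, 0, 0, 1], vector [1, 1, 1, 1], vector [1, 1, 1, 0]}"

end

theory Submission
  imports Defs
begin

text \<open>
  The cube graph is diagonalised by the Walsh functions \<open>x \<mapsto> (-1) ^ (\<Sum>i\<in>S. x i)\<close>, one for each
  set \<open>S\<close> of coordinates: flipping a coordinate of \<open>S\<close> changes the sign of the function, so it is
  an eigenvector with eigenvalue \<open>- 2 * card S / n\<close>. The eigenspace of level \<open>k\<close> is therefore
  spanned by the Walsh functions with \<open>card S = k\<close> and has dimension \<open>n choose k\<close>
  (\<open>eigenspace_cube_graph_level\<close>, \<open>dim_walsh_level\<close>). For \<open>k > 0\<close> a vertex set \<open>W\<close> integrates
  it iff the Fourier coefficients of the indicator of \<open>W\<close> at level \<open>k\<close> vanish; below, \<open>W\<close> is then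
  called balanced at level \<open>k\<close>.

  For \<open>n = 4\<close> the numbers \<open>\<bar>\<lambda> + 1\<bar>\<close> at the levels 0, 1, 2, 3, 4 are 1, 1/2, 0, 1/2, 1.
  A frequency ordering thus runs through the levels 0, 4, then 1 and 3 in either order, then 2,
  and the dimensions add up to 1, 2, 6, 10, 16. A nonempty \<open>W\<close> that is integrated up to one of
  these points satisfies:

  \<^item> up to dimension 1 or 2, the ratio is at least 1/2;

  \<^item> up to dimension 6 or 10, \<open>W\<close> has at least 4 elements (\<open>card_ge_4_of_balanced\<close>): level 4 forces
    as many even as odd vertices, and two vertices of opposite parity can be neither antipodal
    (level 1) nor equal (level 3). The ratio is thus at least 4/6 or 4/10;

  \<^item> up to dimension 16, all nonconstant Fourier coefficients vanish, \<open>W\<close> is the whole cube and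
    the ratio is 1 (\<open>balanced_all_imp_UNIV\<close>).

  So 2/5 is a lower bound for the efficacy, attained exactly when the levels 1, 3 and 4 are
  balanced and \<open>W\<close> has 4 elements. The odd levels are balanced iff \<open>W\<close> is closed under taking
  antipodes (\<open>odd_balanced_iff_antipodal\<close>), and level 4 is balanced iff \<open>W\<close> has equally many even
  and odd vertices; both are plain for the lifted Hamming code.

  An optimal \<open>W\<close> contains vertices \<open>a\<close> and \<open>b\<close> of opposite parity together with the antipode of
  \<open>b\<close>. The distance from \<open>a\<close> to \<open>b\<close> is 1 or 3, and in the second case \<open>a\<close> has distance 1 from the
  antipode of \<open>b\<close>. Hence \<open>W\<close> contains two adjacent vertices (\<open>not_stable_of_balanced\<close>).
\<close>

section \<open>Walsh functions\<close>

text \<open>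
  The vertices form an elementary abelian 2-group under componentwise addition. Adding
  \<open>axis i 1\<close> flips the coordinate \<open>i\<close>, and adding \<open>1\<close> leads to the antipode.
\<close>

lemma two_type_cases: "(a::2) = 0 \<or> a = 1"
  using exhaust_2[of a] by auto

lemma two_type_add_self [simp]: "(a::2) + a = 0"
  using two_type_cases[of a] by auto

lemma cube_add_self [simp]: "(x::2 ^ 'n) + x = 0"
  unfolding vec_eq_iff vector_add_component two_type_add_self by simp

lemma cube_add_eq_0_iff: "(x::2 ^ 'n) + y = 0 \<longleftrightarrow> x = y"
  by (metis add.right_neutral add_right_imp_eq cube_add_self)

lemma cube_add_cancel [simp]: "(x::2 ^ 'n) + y + y = x"
  by (simp add: add.assoc)

definition bit_sign :: "2 \<Rightarrow> real" where
  "bit_sign a = (if a = 0 then 1 else - 1)"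

lemma bit_sign_simps [simp]: "bit_sign 0 = 1" "bit_sign 1 = - 1"
  by (simp_all add: bit_sign_def)

lemma bit_sign_add: "bit_sign (a + b) = bit_sign a * bit_sign b"
  using two_type_cases[of a] two_type_cases[of b] by auto

definition walsh :: "'n set \<Rightarrow> real ^ (2 ^ 'n::finite)" where
  "walsh S = (\<chi> x. \<Prod>i\<in>S. bit_sign (x $ i))"

text \<open>
  The Walsh functions are the characters of this group; nearly everything below reduces to their
  values at \<open>axis i 1\<close> and at \<open>1\<close>.
\<close>

lemma walsh_add: "walsh S $ (x + y) = walsh S $ x * walsh S $ y"
  by (simp add: walsh_def bit_sign_add prod.distrib)

lemma walsh_0 [simp]: "walsh S $ 0 = 1"
  by (simp add: walsh_def)

lemma walsh_1: "walsh S $ 1 = (- 1) ^ card S"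
  by (simp add: walsh_def)

lemma walsh_axis: "walsh S $ axis i 1 = (if i \<in> S then - 1 else 1)"
proof -
  have "bit_sign (axis i 1 $ j) = (if j = i then - 1 else 1)" for j
    by (simp add: axis_def)
  then show ?thesis
    by (simp add: walsh_def)
qed

lemma walsh_square [simp]: "walsh S $ x * walsh S $ x = 1"
  by (metis walsh_add cube_add_self walsh_0)

lemma walsh_empty: "walsh {} $ x = 1"
  by (simp add: walsh_def)

text \<open>
  The sum over all \<open>S\<close> is the expansion of the product of the factors \<open>1 + (- 1) ^ z i\<close>, and a single
  coordinate with \<open>z i = 1\<close> makes the product vanish.
\<close>

lemma sum_walsh_over_sets:
  fixes z :: "2 ^ 'n::finite"
  shows "(\<Sum>S\<in>UNIV. walsh S $ z) = (if z = 0 then 2 ^ CARD('n) else 0)"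
proof -
  have "(\<Sum>S\<in>UNIV. walsh S $ z) = (\<Prod>i\<in>UNIV. bit_sign (z $ i) + 1)"
    by (simp add: prod_add walsh_def)
  also have "\<dots> = (\<Prod>i\<in>UNIV. if z $ i = 0 then 2 else 0)"
    by (intro prod.cong) (auto simp: bit_sign_def)
  also have "\<dots> = (if z = 0 then 2 ^ CARD('n) else 0)"
    by (auto simp: vec_eq_iff)
  finally show ?thesis .
qed

lemma walsh_completeness:
  fixes x y :: "2 ^ 'n::finite"
  shows "(\<Sum>S\<in>UNIV. walsh S $ x * walsh S $ y) = (if x = y then 2 ^ CARD('n) else 0)"
  using sum_walsh_over_sets[of "x + y"] by (simp add: walsh_add cube_add_eq_0_iff)

lemma sum_shift: "(\<Sum>x\<in>UNIV. f (x + (a::2 ^ 'n::finite))) = (\<Sum>x\<in>UNIV. f x)"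
  by (rule sum.reindex_bij_witness[of _ "\<lambda>x. x + a" "\<lambda>x. x + a"]) auto

text \<open>Flipping a coordinate in \<open>S\<close> permutes the vertices and negates the sum.\<close>

lemma sum_walsh_over_vertices:
  assumes "S \<noteq> {}"
  shows "(\<Sum>x\<in>UNIV. walsh S $ x) = 0"
proof -
  obtain i where "i \<in> S" using assms by auto
  have "(\<Sum>x\<in>UNIV. walsh S $ x) = (\<Sum>x\<in>UNIV. walsh S $ (x + axis i 1))"
    by (simp only: sum_shift)
  also have "\<dots> = - (\<Sum>x\<in>UNIV. walsh S $ x)"
    using \<open>i \<in> S\<close> by (simp add: walsh_add walsh_axis sum_negf)
  finally show ?thesis by simp
qed

lemma walsh_expansion:
  fixes \<phi> :: "real ^ (2 ^ 'n::finite)"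
  shows "(2 ^ CARD('n)) *\<^sub>R \<phi> = (\<Sum>S\<in>UNIV. (\<phi> \<bullet> walsh S) *\<^sub>R walsh S)"
proof (subst vec_eq_iff, rule allI)
  fix x :: "2 ^ 'n"
  have "(\<Sum>S\<in>UNIV. (\<phi> \<bullet> walsh S) *\<^sub>R walsh S) $ x
      = (\<Sum>S\<in>UNIV. \<Sum>y\<in>UNIV. \<phi> $ y * (walsh S $ y * walsh S $ x))"
    by (simp add: inner_vec_def sum_distrib_right mult.assoc)
  also have "\<dots> = (\<Sum>y\<in>UNIV. \<phi> $ y * (\<Sum>S\<in>UNIV. walsh S $ y * walsh S $ x))"
    by (subst sum.swap) (simp add: sum_distrib_left)
  also have "\<dots> = 2 ^ CARD('n) * \<phi> $ x"
    by (simp add: walsh_completeness if_distrib sum.delta cong: if_cong)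
  finally show "((2 ^ CARD('n)) *\<^sub>R \<phi>) $ x = (\<Sum>S\<in>UNIV. (\<phi> \<bullet> walsh S) *\<^sub>R walsh S) $ x"
    by simp
qed

lemma span_range_walsh: "span (range walsh) = (UNIV :: (real ^ (2 ^ 'n::finite)) set)"
proof -
  have "\<phi> \<in> span (range walsh)" for \<phi> :: "real ^ (2 ^ 'n)"
  proof -
    have "(2 ^ CARD('n)) *\<^sub>R \<phi> \<in> span (range walsh)"
      unfolding walsh_expansion by (intro span_sum span_scale span_base) auto
    from span_scale[OF this, of "1 / 2 ^ CARD('n)"] show ?thesis by simp
  qed
  then show ?thesis by auto
qed

text \<open>
  By completeness the Walsh functions span a space whose dimension is the number of sets \<open>S\<close>.
  So there are no coincidences and no linear relations among them.
\<close>

lemma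
  shows independent_range_walsh: "independent (range walsh :: (real ^ (2 ^ 'n::finite)) set)"
    and inj_walsh: "inj (walsh :: 'n set \<Rightarrow> real ^ (2 ^ 'n))"
proof -
  let ?B = "range walsh :: (real ^ (2 ^ 'n)) set"
  have dim: "dim (UNIV :: (real ^ (2 ^ 'n)) set) = 2 ^ CARD('n)"
    by simp
  have fin: "finite ?B" by simp
  have le: "card ?B \<le> 2 ^ CARD('n)"
    using card_image_le[of "UNIV :: 'n set set" walsh] by (simp add: card_Pow flip: Pow_UNIV)
  show "independent ?B"
    by (rule card_le_dim_spanning[of _ UNIV]) (use le dim span_range_walsh in auto)
  then have "card ?B = 2 ^ CARD('n)"
    using dim dim_eq_card[of ?B UNIV] span_range_walsh by (metis span_UNIV)
  then have "card ?B = card (UNIV :: 'n set set)"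
    by (simp add: card_Pow flip: Pow_UNIV)
  then show "inj (walsh :: 'n set \<Rightarrow> real ^ (2 ^ 'n))"
    by (intro eq_card_imp_inj_on) auto
qed

section \<open>The spectrum of the cube graph\<close>

lemma cube_graph_iff_axis: "cube_graph x y \<longleftrightarrow> (\<exists>i. y = x + axis i 1)"
proof -
  have "(x $ j \<noteq> y $ j \<longleftrightarrow> j = i) \<longleftrightarrow> y $ j = x $ j + axis i 1 $ j" for i j
    using two_type_cases[of "x $ j"] two_type_cases[of "y $ j"]
    by (cases "j = i"; elim disjE) (simp_all add: axis_def)
  then have "{j. x $ j \<noteq> y $ j} = {i} \<longleftrightarrow> y = x + axis i 1" for i
    by (simp only: set_eq_iff mem_Collect_eq singleton_iff vec_eq_iff vector_add_component)
  then show ?thesis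
    unfolding cube_graph_def One_nat_def card_1_singleton_iff by (simp only:)
qed

lemma inj_neighbour: "inj (\<lambda>i. x + axis i (1::2))"
  by (auto simp: inj_on_def axis_eq_axis)

lemma neighbours_cube_graph: "{y. cube_graph x y} = range (\<lambda>i. x + axis i 1)"
  by (auto simp: cube_graph_iff_axis)

text \<open>
  The graph is regular, so its degree matrix is a scalar matrix, and the Laplacian compares a
  value of \<open>\<phi>\<close> with the average over the neighbours.
\<close>

lemma laplacian_cube_graph:
  fixes \<phi> :: "real ^ (2 ^ 'n::finite)"
  shows "(laplacian cube_graph *v \<phi>) $ x
    = (\<Sum>i\<in>UNIV. \<phi> $ (x + axis i 1)) / CARD('n) - \<phi> $ x"
proof -
  let ?n = "real CARD('n)"
  have "card (Collect (cube_graph y)) = CARD('n)" for y :: "2 ^ 'n"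
    unfolding neighbours_cube_graph by (rule card_image[OF inj_neighbour])
  then have degree: "degree_matrix (cube_graph :: 2 ^ 'n \<Rightarrow> _) = ?n *\<^sub>R mat 1"
    by (intro vec_eq_iff[THEN iffD2] allI) (simp add: degree_matrix_def mat_def)
  have inverse: "matrix_inv (?n *\<^sub>R mat 1) = ((1 / ?n) *\<^sub>R mat 1 :: real ^ (2 ^ 'n) ^ (2 ^ 'n))"
    unfolding matrix_inv_def
  proof (rule some_equality)
    fix B :: "real ^ (2 ^ 'n) ^ (2 ^ 'n)"
    assume "(?n *\<^sub>R mat 1) ** B = mat 1 \<and> B ** (?n *\<^sub>R mat 1) = mat 1"
    then have "?n *\<^sub>R B = mat 1"
      by (simp flip: scalar_matrix_assoc)
    then have "(1 / ?n) *\<^sub>R (?n *\<^sub>R B) = (1 / ?n) *\<^sub>R mat 1"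
      by (rule arg_cong)
    then show "B = (1 / ?n) *\<^sub>R mat 1"
      by simp
  qed (simp_all add: matrix_scalar_ac flip: scalar_matrix_assoc)
  have "laplacian cube_graph *v \<phi> = (1 / ?n) *\<^sub>R (adjacency_matrix cube_graph *v \<phi>) - \<phi>"
    by (simp add: laplacian_def degree inverse matrix_scalar_ac matrix_vector_mult_diff_rdistrib
        scaleR_matrix_vector_assoc)
  then have "(laplacian cube_graph *v \<phi>) $ x = (adjacency_matrix cube_graph *v \<phi>) $ x / ?n - \<phi> $ x"
    by simp
  also have "(adjacency_matrix cube_graph *v \<phi>) $ x = (\<Sum>y\<in>UNIV. (if cube_graph x y then \<phi> $ y else 0))"
    by (auto simp: adjacency_matrix_def matrix_vector_mult_def intro!: sum.cong)
  also have "(\<Sum>y\<in>UNIV. (if cube_graph x y then \<phi> $ y else 0)) = (\<Sum>y\<in>{y. cube_graph x y}. \<phi> $ y)"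
    by (simp add: sum.If_cases)
  also have "\<dots> = (\<Sum>i\<in>UNIV. \<phi> $ (x + axis i 1))"
    by (simp add: neighbours_cube_graph sum.reindex[OF inj_neighbour] o_def)
  finally show ?thesis .
qed

lemma laplacian_walsh:
  fixes S :: "'n::finite set"
  shows "laplacian cube_graph *v walsh S = (- 2 * real (card S) / CARD('n)) *\<^sub>R walsh S"
proof (subst vec_eq_iff, rule allI)
  fix x :: "2 ^ 'n"
  have "(\<Sum>i\<in>UNIV. walsh S $ axis i 1) = (\<Sum>i\<in>UNIV. 1 - (if i \<in> S then 2 else 0 :: real))"
    by (intro sum.cong) (auto simp: walsh_axis)
  also have "\<dots> = real CARD('n) - 2 * real (card S)"
    by (simp add: sum_subtractf sum.If_cases)
  finally have axes: "(\<Sum>i\<in>UNIV. walsh S $ axis i 1) = real CARD('n) - 2 * real (card S)" .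
  have "(laplacian cube_graph *v walsh S) $ x
      = walsh S $ x * (\<Sum>i\<in>UNIV. walsh S $ axis i 1) / CARD('n) - walsh S $ x"
    by (simp add: laplacian_cube_graph walsh_add sum_distrib_left)
  then show "(laplacian cube_graph *v walsh S) $ x = ((- 2 * real (card S) / CARD('n)) *\<^sub>R walsh S) $ x"
    unfolding axes by (simp add: field_simps)
qed

text \<open>
  Symmetry makes eigenvectors of different eigenvalues orthogonal, which discards all Walsh
  functions of the wrong level from the expansion of an eigenvector.
\<close>

lemma laplacian_self_adjoint:
  fixes \<phi> \<psi> :: "real ^ (2 ^ 'n::finite)"
  shows "(laplacian cube_graph *v \<phi>) \<bullet> \<psi> = \<phi> \<bullet> (laplacian cube_graph *v \<psi>)"
proof -
  have "(\<Sum>x\<in>UNIV. (\<Sum>i\<in>UNIV. \<phi> $ (x + axis i 1)) * \<psi> $ x)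
      = (\<Sum>i\<in>UNIV. \<Sum>x\<in>UNIV. \<phi> $ (x + axis i 1) * \<psi> $ x)"
    by (subst sum.swap) (simp add: sum_distrib_right)
  also have "\<dots> = (\<Sum>i\<in>UNIV. \<Sum>x\<in>UNIV. \<phi> $ x * \<psi> $ (x + axis i 1))"
  proof (rule sum.cong[OF refl])
    fix i :: 'n
    show "(\<Sum>x\<in>UNIV. \<phi> $ (x + axis i 1) * \<psi> $ x) = (\<Sum>x\<in>UNIV. \<phi> $ x * \<psi> $ (x + axis i 1))"
      using sum_shift[of "\<lambda>x. \<phi> $ x * \<psi> $ (x + axis i 1)" "axis i 1"] by simp
  qed
  also have "\<dots> = (\<Sum>x\<in>UNIV. \<phi> $ x * (\<Sum>i\<in>UNIV. \<psi> $ (x + axis i 1)))"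
    by (subst sum.swap) (simp add: sum_distrib_left)
  finally show ?thesis
    by (simp add: inner_vec_def laplacian_cube_graph algebra_simps sum_subtractf
        flip: sum_divide_distrib)
qed

lemma eigenspace_cube_graph:
  "eigenspace cube_graph \<mu>
    = span (walsh ` {S :: 'n::finite set. - 2 * real (card S) / CARD('n) = \<mu>})"
    (is "_ = span ?B")
proof (intro subset_antisym subsetI)
  fix \<phi> :: "real ^ (2 ^ 'n)"
  assume "\<phi> \<in> eigenspace cube_graph \<mu>"
  then have \<phi>: "laplacian cube_graph *v \<phi> = \<mu> *\<^sub>R \<phi>"
    by (simp add: eigenspace_def)
  have orth: "\<phi> \<bullet> walsh S = 0" if "- 2 * real (card S) / CARD('n) \<noteq> \<mu>" for S :: "'n set"
  proof -
    have "\<mu> * (\<phi> \<bullet> walsh S) = (- 2 * real (card S) / CARD('n)) * (\<phi> \<bullet> walsh S)"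
      using laplacian_self_adjoint[of \<phi> "walsh S"] by (simp add: \<phi> laplacian_walsh)
    then show ?thesis using that by (metis mult_right_cancel)
  qed
  have "(2 ^ CARD('n)) *\<^sub>R \<phi> \<in> span ?B"
    unfolding walsh_expansion
  proof (rule span_sum)
    fix S :: "'n set"
    show "(\<phi> \<bullet> walsh S) *\<^sub>R walsh S \<in> span ?B"
    proof (cases "- 2 * real (card S) / CARD('n) = \<mu>")
      case True
      then show ?thesis by (intro span_scale span_base) auto
    next
      case False
      then show ?thesis using orth by (simp add: span_zero)
    qed
  qed
  from span_scale[OF this, of "1 / 2 ^ CARD('n)"] show "\<phi> \<in> span ?B" by simp
next
  fix \<phi> :: "real ^ (2 ^ 'n)"
  assume "\<phi> \<in> span ?B"
  moreover have "subspace (eigenspace (cube_graph :: 2 ^ 'n \<Rightarrow> _) \<mu>)"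
    by (auto simp: eigenspace_def subspace_def matrix_vector_right_distrib scaleR_add_right
        matrix_vector_mult_scaleR)
  moreover have "?B \<subseteq> eigenspace cube_graph \<mu>"
    by (auto simp: eigenspace_def laplacian_walsh)
  ultimately show "\<phi> \<in> eigenspace cube_graph \<mu>"
    by (meson span_minimal subsetD)
qed

lemma independent_walsh_image: "independent (walsh ` \<S>)"
  by (rule independent_mono[OF independent_range_walsh]) auto

definition walsh_level :: "nat \<Rightarrow> (real ^ (2 ^ 'n::finite)) set" where
  "walsh_level k = span (walsh ` {S. card S = k})"

lemma eigenspace_cube_graph_level:
  "eigenspace (cube_graph :: 2 ^ 'n::finite \<Rightarrow> _) (- 2 * real k / CARD('n)) = walsh_level k"
  by (simp add: eigenspace_cube_graph walsh_level_def)

lemma dim_walsh_level: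
  "dim (walsh_level k :: (real ^ (2 ^ 'n::finite)) set) = CARD('n) choose k"
proof -
  have "card {S :: 'n set. card S = k} = CARD('n) choose k"
    using n_subsets[of "UNIV :: 'n set" k] by simp
  moreover have "card (walsh ` {S :: 'n set. card S = k}) = card {S :: 'n set. card S = k}"
    by (rule card_image) (meson inj_walsh inj_on_subset subset_UNIV)
  ultimately show ?thesis
    unfolding walsh_level_def dim_span
    by (simp add: dim_eq_card_independent[OF independent_walsh_image])
qed

lemma eigenvalues_cube_graph:
  "eigenvalues (cube_graph :: 2 ^ 'n::finite \<Rightarrow> _) = (\<lambda>k. - 2 * real k / CARD('n)) ` {..CARD('n)}"
proof (intro subset_antisym subsetI)
  fix \<mu>
  assume "\<mu> \<in> eigenvalues (cube_graph :: 2 ^ 'n \<Rightarrow> _)"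
  then obtain \<phi> :: "real ^ (2 ^ 'n)" where \<phi>: "\<phi> \<noteq> 0" "\<phi> \<in> eigenspace cube_graph \<mu>"
    unfolding eigenvalues_def eigenspace_def by blast
  have "{S :: 'n set. - 2 * real (card S) / CARD('n) = \<mu>} \<noteq> {}"
  proof
    assume "{S :: 'n set. - 2 * real (card S) / CARD('n) = \<mu>} = {}"
    with \<phi>(2) have "\<phi> \<in> span {}"
      unfolding eigenspace_cube_graph by (simp only: image_empty)
    with \<phi>(1) show False by simp
  qed
  then obtain S :: "'n set" where "\<mu> = - 2 * real (card S) / CARD('n)" by auto
  moreover have "card S \<le> CARD('n)" by (simp add: card_mono)
  ultimately show "\<mu> \<in> (\<lambda>k. - 2 * real k / CARD('n)) ` {..CARD('n)}" by auto
next
  fix \<mu>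
  assume "\<mu> \<in> (\<lambda>k. - 2 * real k / CARD('n)) ` {..CARD('n)}"
  then obtain k where k: "k \<le> CARD('n)" "\<mu> = - 2 * real k / CARD('n)" by auto
  obtain S :: "'n set" where "card S = k" using k(1) by (metis obtain_subset_with_card_n)
  moreover have "walsh S \<noteq> 0"
    by (metis walsh_0 zero_index zero_neq_one)
  ultimately show "\<mu> \<in> eigenvalues (cube_graph :: 2 ^ 'n \<Rightarrow> _)"
    using laplacian_walsh[of S] k(2) by (auto simp: eigenvalues_def)
qed


section \<open>Integration as vanishing Fourier coefficients\<close>

text \<open>
  The sum over \<open>W\<close> is the Fourier coefficient at \<open>S\<close> of the indicator function of \<open>W\<close>.
\<close>

definition balanced :: "(2 ^ 'n::finite) set \<Rightarrow> nat \<Rightarrow> bool" where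
  "balanced W k \<longleftrightarrow> (\<forall>S. card S = k \<longrightarrow> (\<Sum>w\<in>W. walsh S $ w) = 0)"

lemma balancedD: "balanced W (card S) \<Longrightarrow> (\<Sum>w\<in>W. walsh S $ w) = 0"
  by (simp add: balanced_def)

text \<open>
  Integration of a basis is integration of the whole eigenspace, so the choice of the basis in
  \<open>integrates_space\<close> is immaterial and the Walsh functions may be used.
\<close>

lemma subspace_integrates:
  fixes W :: "'a::finite set"
  shows "subspace {\<phi>. integrates W \<phi>}"
proof (rule subspaceI)
  fix c \<phi>
  assume "\<phi> \<in> {\<phi>. integrates W \<phi>}"
  then have "c * ((\<Sum>w\<in>W. \<phi> $ w) / real (card W)) = c * ((\<Sum>v\<in>UNIV. \<phi> $ v) / real CARD('a))"
    by (simp add: integrates_def)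
  then show "c *\<^sub>R \<phi> \<in> {\<phi>. integrates W \<phi>}"
    by (simp add: integrates_def flip: sum_distrib_left)
qed (simp_all add: integrates_def sum.distrib add_divide_distrib)

lemma integrates_walsh_level_iff:
  "integrates_space W (walsh_level k) \<longleftrightarrow> (\<forall>S. card S = k \<longrightarrow> integrates W (walsh S))"
proof
  assume "integrates_space W (walsh_level k)"
  then obtain B where B: "span B = walsh_level k" "B \<subseteq> {\<phi>. integrates W \<phi>}"
    by (auto simp: integrates_space_def)
  then have "walsh_level k \<subseteq> {\<phi>. integrates W \<phi>}"
    using span_minimal[OF B(2) subspace_integrates] by simp
  moreover have "walsh S \<in> walsh_level k" if "card S = k" for S
    using that by (auto simp: walsh_level_def intro: span_base)
  ultimately show "\<forall>S. card S = k \<longrightarrow> integrates W (walsh S)"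
    by blast
next
  assume "\<forall>S. card S = k \<longrightarrow> integrates W (walsh S)"
  then show "integrates_space W (walsh_level k)"
    unfolding integrates_space_def walsh_level_def
    by (intro exI[of _ "walsh ` {S. card S = k}"]) (auto simp: independent_walsh_image)
qed

text \<open>Above level 0 the average over all vertices is 0, and only the sum over \<open>W\<close> remains.\<close>

lemma integrates_walsh_level_iff_balanced:
  assumes "W \<noteq> {}" "k > 0"
  shows "integrates_space W (walsh_level k) \<longleftrightarrow> balanced W k"
proof -
  have "integrates W (walsh S) \<longleftrightarrow> (\<Sum>w\<in>W. walsh S $ w) = 0" if "card S = k" for S
  proof -
    have "S \<noteq> {}" using that assms(2) by auto
    then show ?thesis
      using assms(1) by (simp add: integrates_def sum_walsh_over_vertices card_eq_0_iff)
  qed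
  then show ?thesis
    by (simp add: integrates_walsh_level_iff balanced_def)
qed

lemma integrates_walsh_level_0:
  fixes W :: "(2 ^ 'n::finite) set"
  assumes "W \<noteq> {}"
  shows "integrates_space W (walsh_level 0)"
  using assms by (simp add: integrates_walsh_level_iff integrates_def walsh_empty)

lemma walsh_inversion:
  fixes W :: "(2 ^ 'n::finite) set"
  shows "(\<Sum>S\<in>UNIV. (\<Sum>w\<in>W. walsh S $ w) * walsh S $ x) = (if x \<in> W then 2 ^ CARD('n) else 0)"
proof -
  have "(\<Sum>S\<in>UNIV. (\<Sum>w\<in>W. walsh S $ w) * walsh S $ x)
      = (\<Sum>w\<in>W. \<Sum>S\<in>UNIV. walsh S $ w * walsh S $ x)"
    by (subst sum.swap) (simp add: sum_distrib_right)
  then show ?thesis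
    by (simp add: walsh_completeness)
qed

text \<open>
  At a vertex outside \<open>W\<close> the inversion formula would read \<open>card W = 0\<close>, since only the
  coefficient at the empty set survives.
\<close>

lemma balanced_all_imp_UNIV:
  fixes W :: "(2 ^ 'n::finite) set"
  assumes "W \<noteq> {}" and balanced: "\<And>k. 0 < k \<Longrightarrow> k \<le> CARD('n) \<Longrightarrow> balanced W k"
  shows "W = UNIV"
proof -
  have "x \<in> W" for x
  proof (rule ccontr)
    assume "x \<notin> W"
    have zero: "(\<Sum>w\<in>W. walsh S $ w) = 0" if "S \<noteq> {}" for S
      using that by (intro balancedD balanced) (auto simp: card_gt_0_iff card_mono)
    have "(\<Sum>S\<in>UNIV. (\<Sum>w\<in>W. walsh S $ w) * walsh S $ x)
        = (\<Sum>S\<in>(UNIV :: 'n set set). if S = {} then real (card W) else 0)"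
      by (intro sum.cong) (auto simp: walsh_empty zero)
    then show False
      using \<open>x \<notin> W\<close> \<open>W \<noteq> {}\<close> by (simp add: walsh_inversion)
  qed
  then show ?thesis by auto
qed

text \<open>
  Passing to antipodes multiplies the Fourier coefficient at \<open>S\<close> by \<open>(- 1) ^ card S\<close>. Invariance
  of the indicator function under this means that the coefficients at odd levels are 0.
\<close>

lemma odd_balanced_iff_antipodal:
  fixes W :: "(2 ^ 'n::finite) set"
  shows "(\<forall>k. odd k \<longrightarrow> balanced W k) \<longleftrightarrow> (\<forall>x. x + 1 \<in> W \<longleftrightarrow> x \<in> W)"
proof
  assume bal: "\<forall>k. odd k \<longrightarrow> balanced W k"
  show "\<forall>x. x + 1 \<in> W \<longleftrightarrow> x \<in> W"
  proof
    fix x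
    have "(\<Sum>S\<in>UNIV. (\<Sum>w\<in>W. walsh S $ w) * walsh S $ (x + 1))
        = (\<Sum>S\<in>UNIV. (\<Sum>w\<in>W. walsh S $ w) * walsh S $ x)"
    proof (rule sum.cong[OF refl])
      fix S
      show "(\<Sum>w\<in>W. walsh S $ w) * walsh S $ (x + 1) = (\<Sum>w\<in>W. walsh S $ w) * walsh S $ x"
        using bal by (cases "odd (card S)") (simp_all add: balancedD walsh_add walsh_1)
    qed
    then show "x + 1 \<in> W \<longleftrightarrow> x \<in> W"
      by (auto simp: walsh_inversion split: if_splits)
  qed
next
  assume closed: "\<forall>x. x + 1 \<in> W \<longleftrightarrow> x \<in> W"
  show "\<forall>k. odd k \<longrightarrow> balanced W k"
    unfolding balanced_def
  proof (intro allI impI)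
    fix k and S :: "'n set"
    assume "odd k" "card S = k"
    have "(\<Sum>w\<in>W. walsh S $ w) = (\<Sum>w\<in>W. walsh S $ (w + 1))"
      by (rule sum.reindex_bij_witness[of _ "\<lambda>x. x + 1" "\<lambda>x. x + 1"]) (use closed in auto)
    also have "\<dots> = - (\<Sum>w\<in>W. walsh S $ w)"
      using \<open>odd k\<close> \<open>card S = k\<close> by (simp add: walsh_add walsh_1 sum_negf)
    finally show "(\<Sum>w\<in>W. walsh S $ w) = 0" by simp
  qed
qed

text \<open>
  The function \<open>walsh UNIV\<close> is the parity of a vertex. Balance at the top level means that even and
  odd vertices of \<open>W\<close> are equal in number.
\<close>

lemma walsh_cases: "walsh S $ x = 1 \<or> walsh S $ x = - 1"
  using walsh_square[of S x] by (simp only: square_eq_1_iff)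

lemma balanced_top_imp_even_card:
  fixes W :: "(2 ^ 'n::finite) set"
  assumes "balanced W CARD('n)"
  shows "even (card W)"
proof -
  have "real (card W) = (\<Sum>w\<in>W. 1 + walsh UNIV $ w)"
    using assms by (simp add: sum.distrib balancedD)
  also have "\<dots> = (\<Sum>w\<in>W. if walsh UNIV $ w = 1 then 2 else 0)"
    by (intro sum.cong) (use walsh_cases in fastforce)+
  also have "\<dots> = real (2 * card {w \<in> W. walsh UNIV $ w = 1})"
    by (simp add: sum.If_cases Int_def)
  finally have "card W = 2 * card {w \<in> W. walsh UNIV $ w = 1}"
    by (simp only: of_nat_eq_iff)
  then show ?thesis by simp
qed

lemma balanced_top_imp_opposite_parity:
  fixes W :: "(2 ^ 'n::finite) set"
  assumes "balanced W CARD('n)" "a \<in> W"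
  obtains b where "b \<in> W" "walsh UNIV $ (a + b) = - 1"
proof -
  have "\<exists>b\<in>W. walsh UNIV $ (a + b) \<noteq> 1"
  proof (rule ccontr)
    assume "\<not> (\<exists>b\<in>W. walsh UNIV $ (a + b) \<noteq> 1)"
    then have "(\<Sum>b\<in>W. walsh UNIV $ (a + b)) = card W" by simp
    moreover have "(\<Sum>b\<in>W. walsh UNIV $ (a + b)) = 0"
      using assms(1) by (simp add: walsh_add balancedD flip: sum_distrib_left)
    ultimately show False using \<open>a \<in> W\<close> by auto
  qed
  then show ?thesis using that walsh_cases by blast
qed

lemma walsh_singleton: "walsh {i} $ x = 1 \<longleftrightarrow> x $ i = 0"
  using two_type_cases[of "x $ i"] by (auto simp: walsh_def)

lemma walsh_Compl: "walsh (- S) $ x = walsh UNIV $ x * walsh S $ x"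
proof -
  have union: "walsh UNIV $ x = walsh S $ x * walsh (- S) $ x"
    using prod.union_disjoint[of S "- S" "\<lambda>i. bit_sign (x $ i)"] by (simp add: walsh_def)
  have "walsh UNIV $ x * walsh S $ x = (walsh S $ x * walsh S $ x) * walsh (- S) $ x"
    unfolding union by (simp only: ac_simps)
  then show ?thesis by simp
qed

text \<open>
  The size of \<open>W\<close> is even, so only two vertices \<open>x\<close> and \<open>y\<close> have to be excluded. In that case a
  balanced level makes its Walsh functions equal to \<open>- 1\<close> at \<open>x + y\<close>. Level 1 then gives
  \<open>x + y = 1\<close>, and level \<open>n - 1\<close>, together with the top level, gives \<open>x + y = 0\<close>. Either way \<open>x + y\<close>
  has even parity when \<open>n\<close> is even, which contradicts the balance at the top level.
\<close>

lemma card_ge_4_of_balanced: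
  fixes W :: "(2 ^ 'n::finite) set"
  assumes "W \<noteq> {}" "even CARD('n)" and top: "balanced W CARD('n)"
    and "balanced W 1 \<or> balanced W (CARD('n) - 1)"
  shows "card W \<ge> 4"
proof -
  have "card W \<noteq> 2"
  proof
    assume "card W = 2"
    then obtain x y where W: "W = {x, y}" "x \<noteq> y"
      by (meson card_2_iff)
    define z where "z = x + y"
    have opposite: "walsh S $ z = - 1" if "balanced W (card S)" for S
      using balancedD[OF that] W walsh_cases[of S x] walsh_cases[of S y]
      by (auto simp: z_def walsh_add)
    have z: "walsh UNIV $ z = - 1"
      using opposite[of UNIV] top by simp
    from assms(4) have "z = 1 \<or> z = 0"
    proof
      assume "balanced W 1"
      then have "z $ i \<noteq> 0" for i
        using opposite[of "{i}"] walsh_singleton[of i z] by simp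
      then have "z $ i = 1" for i
        using two_type_cases[of "z $ i"] by blast
      then show ?thesis
        by (simp add: vec_eq_iff)
    next
      assume bal: "balanced W (CARD('n) - 1)"
      have "z $ i = 0" for i
      proof -
        have "walsh (- {i}) $ z = - 1"
          using bal by (intro opposite) (simp add: Compl_eq_Diff_UNIV card_Diff_subset)
        then show ?thesis
          using z walsh_Compl[of "{i}" z] walsh_singleton[of i z] by simp
      qed
      then show ?thesis by (simp add: vec_eq_iff)
    qed
    then show False
      using z \<open>even CARD('n)\<close> by (auto simp: walsh_1)
  qed
  moreover have "card W > 0" using \<open>W \<noteq> {}\<close> by (simp add: card_gt_0_iff)
  moreover have "m \<noteq> 2 \<Longrightarrow> m > 0 \<Longrightarrow> even m \<Longrightarrow> 4 \<le> m" for m :: nat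
    by presburger
  ultimately show ?thesis using balanced_top_imp_even_card[OF top] by metis
qed

section \<open>Balanced sets contain adjacent vertices\<close>

lemma walsh_UNIV_add: "walsh UNIV $ (x + y) = (- 1) ^ card {i. x $ i \<noteq> y $ i}"
proof -
  have "bit_sign (x $ i + y $ i) = (if x $ i \<noteq> y $ i then - 1 else 1)" for i
    using two_type_cases[of "x $ i"] two_type_cases[of "y $ i"] by (elim disjE) simp_all
  then have "walsh UNIV $ (x + y) = (\<Prod>i\<in>UNIV. if x $ i \<noteq> y $ i then - 1 else 1)"
    by (simp add: walsh_def)
  also have "\<dots> = (- 1) ^ card {i. x $ i \<noteq> y $ i}"
    by (subst prod.If_cases) auto
  finally show ?thesis .
qed

lemma hamming_distance_antipode:
  fixes x y :: "2 ^ 'n::finite"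
  shows "card {i. x $ i \<noteq> (y + 1) $ i} = CARD('n) - card {i. x $ i \<noteq> y $ i}"
proof -
  have "x $ i \<noteq> (y + 1) $ i \<longleftrightarrow> \<not> x $ i \<noteq> y $ i" for i
    using two_type_cases[of "x $ i"] two_type_cases[of "y $ i"] by (elim disjE) simp_all
  then have "{i. x $ i \<noteq> (y + 1) $ i} = - {i. x $ i \<noteq> y $ i}" by auto
  then show ?thesis by (simp add: Compl_eq_Diff_UNIV card_Diff_subset)
qed

text \<open>
  Two vertices of opposite parity are at distance 1 or 3, and distance 3 becomes distance 1 when
  one of them is replaced by its antipode.
\<close>

lemma not_stable_of_balanced:
  fixes W :: "(2 ^ 4) set"
  assumes "W \<noteq> {}" "balanced W 1" "balanced W 3" "balanced W 4"
  shows "\<not> stable_set cube_graph W"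
proof
  assume stable: "stable_set cube_graph W"
  have "balanced W k" if "odd k" for k
  proof (cases "k \<le> 4")
    case True
    with that have "k = 1 \<or> k = 3" by presburger
    then show ?thesis using assms by auto
  next
    case False
    then have "card S \<noteq> k" for S :: "4 set"
      using card_mono[of UNIV S] by simp
    then show ?thesis by (simp add: balanced_def)
  qed
  then have antipodal: "x + 1 \<in> W \<longleftrightarrow> x \<in> W" for x
    using odd_balanced_iff_antipodal by blast
  obtain a where "a \<in> W" using assms(1) by auto
  obtain b where "b \<in> W" and b: "walsh UNIV $ (a + b) = - 1"
    using balanced_top_imp_opposite_parity[of W a] assms(4) \<open>a \<in> W\<close> by auto
  let ?d = "card {i. a $ i \<noteq> b $ i}"
  have "odd ?d"
    using b by (cases "even ?d") (simp_all add: walsh_UNIV_add)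
  moreover have "?d \<le> 4"
    using card_mono[of UNIV "{i. a $ i \<noteq> b $ i}"] by simp
  ultimately have "?d = 1 \<or> ?d = 3" by presburger
  then have "cube_graph a b \<or> cube_graph a (b + 1)"
    using hamming_distance_antipode[of a b]
    by (auto simp: cube_graph_def simp del: vector_add_component)
  moreover have "\<not> cube_graph a v" if "v \<in> W" for v
  proof (cases "a = v")
    case True
    then show ?thesis by (simp add: cube_graph_def)
  next
    case False
    then show ?thesis
      using pairwiseD[OF stable[unfolded stable_set_def] \<open>a \<in> W\<close> that] by simp
  qed
  ultimately show False
    using \<open>b \<in> W\<close> antipodal[of b] by blast
qed

section \<open>Frequency orderings and efficacies on the 4-dimensional cube\<close>

lemma eigenspace_cube_graph_4:
  "eigenspace (cube_graph :: 2 ^ 4 \<Rightarrow> _) (- real k / 2) = walsh_level k"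
  using eigenspace_cube_graph_level[where 'n = 4, of k] by simp

lemma eigenvalues_cube_graph_4:
  "eigenvalues (cube_graph :: 2 ^ 4 \<Rightarrow> _) = {0, - 1 / 2, - 1, - 3 / 2, - 2}"
proof -
  have "{..CARD(4)} = {0, 1, 2, 3, 4}" by auto
  then show ?thesis
    unfolding eigenvalues_cube_graph by (simp add: insert_commute)
qed

text \<open>
  After the prescribed head \<open>0\<close>, the values \<open>\<bar>\<mu> + 1\<bar>\<close> at \<open>- 2\<close> and at \<open>- 1\<close> are the largest and the
  smallest, which fixes the second and the last place; \<open>- 1 / 2\<close> and \<open>- 3 / 2\<close> are tied.
\<close>

lemma frequency_lists_4:
  "distinct ls \<and> set ls = {0, - 1 / 2, - 1, - 3 / 2, - 2 :: real} \<and> ls \<noteq> [] \<and> hd ls = 0 \<and>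
     sorted_wrt (\<lambda>a b. \<bar>a + 1\<bar> \<ge> \<bar>b + 1\<bar>) ls
   \<longleftrightarrow> ls = [0, - 2, - 1 / 2, - 3 / 2, - 1] \<or> ls = [0, - 2, - 3 / 2, - 1 / 2, - 1]"
  (is "?L \<longleftrightarrow> ?R")
proof
  assume L: ?L
  then have "length ls = 5" using distinct_card[of ls] by simp
  with L obtain b c d e where ls: "ls = [0, b, c, d, e]"
    by (auto simp: numeral_eq_Suc length_Suc_conv)
  from L have mem: "b \<in> {- 1 / 2, - 1, - 3 / 2, - 2}" "c \<in> {- 1 / 2, - 1, - 3 / 2, - 2}"
      "d \<in> {- 1 / 2, - 1, - 3 / 2, - 2}" "e \<in> {- 1 / 2, - 1, - 3 / 2, - 2}"
    and all: "- 2 \<in> {b, c, d, e}" "- 1 \<in> {b, c, d, e}" and dist: "distinct [b, c, d, e]"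
    and sorted: "sorted_wrt (\<lambda>a b. \<bar>a + 1\<bar> \<ge> \<bar>b + 1\<bar>) [b, c, d, e]"
    unfolding ls by auto
  have bounds: "\<forall>x\<in>{b, c, d, e}. \<bar>x + 1\<bar> \<le> \<bar>b + 1\<bar> \<and> \<bar>e + 1\<bar> \<le> \<bar>x + 1\<bar>"
    using sorted by simp
  have "\<bar>b + 1\<bar> \<ge> 1" "\<bar>e + 1\<bar> \<le> 0"
    using bspec[OF bounds all(1)] bspec[OF bounds all(2)] by simp_all
  then have "b = - 2" "e = - 1"
    using mem by auto
  then show ?R
    using mem(2,3) dist unfolding ls by (elim insertE emptyE) simp_all
next
  assume ?R
  then show ?L by auto
qed

lemma frequency_ordering_cube_graph_4:
  "frequency_ordering (cube_graph :: 2 ^ 4 \<Rightarrow> _) \<Lambda>s \<longleftrightarrow>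
     \<Lambda>s = map walsh_level [0, 4, 1, 3, 2] \<or> \<Lambda>s = map walsh_level [0, 4, 3, 1, 2]"
proof -
  have levels:
    "eigenspace (cube_graph :: 2 ^ 4 \<Rightarrow> _) 0 = walsh_level 0"
    "eigenspace (cube_graph :: 2 ^ 4 \<Rightarrow> _) (- 1 / 2) = walsh_level 1"
    "eigenspace (cube_graph :: 2 ^ 4 \<Rightarrow> _) (- 1) = walsh_level 2"
    "eigenspace (cube_graph :: 2 ^ 4 \<Rightarrow> _) (- 3 / 2) = walsh_level 3"
    "eigenspace (cube_graph :: 2 ^ 4 \<Rightarrow> _) (- 2) = walsh_level 4"
    by (simp_all flip: eigenspace_cube_graph_4)
  have "frequency_ordering (cube_graph :: 2 ^ 4 \<Rightarrow> _) \<Lambda>s \<longleftrightarrow>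
      \<Lambda>s = map (eigenspace cube_graph) [0, - 2, - 1 / 2, - 3 / 2, - 1] \<or>
      \<Lambda>s = map (eigenspace cube_graph) [0, - 2, - 3 / 2, - 1 / 2, - 1]"
    \<comment> \<open>Reassociating the conjunction separates the condition on \<open>\<Lambda>s\<close> from those on the eigenvalues.\<close>
    unfolding frequency_ordering_def eigenvalues_cube_graph_4 conj_assoc[symmetric]
      frequency_lists_4[unfolded conj_assoc[symmetric]] by blast
  then show ?thesis
    by (simp only: list.map levels)
qed

lemma dim_walsh_level_4:
  "dim (walsh_level 0 :: (real ^ (2 ^ 4)) set) = 1" "dim (walsh_level 1 :: (real ^ (2 ^ 4)) set) = 4"
  "dim (walsh_level 2 :: (real ^ (2 ^ 4)) set) = 6" "dim (walsh_level 3 :: (real ^ (2 ^ 4)) set) = 4"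
  "dim (walsh_level 4 :: (real ^ (2 ^ 4)) set) = 1"
  unfolding dim_walsh_level by (simp_all add: numeral_eq_Suc)

text \<open>The set whose minimum is the efficacy.\<close>

definition efficacy_ratios :: "('v::finite \<Rightarrow> 'v \<Rightarrow> bool) \<Rightarrow> 'v set \<Rightarrow> real set" where
  "efficacy_ratios E W =
     {real (card W) / real (\<Sum>\<Lambda>\<leftarrow>take k \<Lambda>s. dim \<Lambda>) | \<Lambda>s k.
            frequency_ordering E \<Lambda>s \<and> 1 \<le> k \<and> k \<le> length \<Lambda>s \<and>
            (\<forall>\<Lambda>\<in>set (take k \<Lambda>s). integrates_space W \<Lambda>)}"

text \<open>
  The five cases are the prefixes of the two frequency orderings, with denominators
  \<open>1\<close>, \<open>1 + 1\<close>, \<open>1 + 1 + 4\<close>, \<open>1 + 1 + 4 + 4\<close> and \<open>1 + 1 + 4 + 4 + 6\<close>.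
\<close>

lemma efficacy_ratios_cube_graph_4:
  fixes W :: "(2 ^ 4) set" and r :: real
  assumes "W \<noteq> {}"
  shows "r \<in> efficacy_ratios cube_graph W \<longleftrightarrow>
    r = card W \<or>
    r = card W / 2 \<and> balanced W 4 \<or>
    r = card W / 6 \<and> balanced W 4 \<and> (balanced W 1 \<or> balanced W 3) \<or>
    r = card W / 10 \<and> balanced W 4 \<and> balanced W 1 \<and> balanced W 3 \<or>
    r = card W / 16 \<and> balanced W 4 \<and> balanced W 1 \<and> balanced W 3 \<and> balanced W 2"
proof -
  define integrated_prefix where "integrated_prefix \<Lambda>s k \<longleftrightarrow>
      r = real (card W) / real (\<Sum>\<Lambda>\<leftarrow>take k \<Lambda>s. dim \<Lambda>) \<and>
      1 \<le> k \<and> k \<le> length \<Lambda>s \<and> (\<forall>\<Lambda>\<in>set (take k \<Lambda>s). integrates_space W \<Lambda>)"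
    for \<Lambda>s :: "(real ^ (2 ^ 4)) set list" and k
  have prefixes: "(\<exists>k. integrated_prefix \<Lambda>s k) \<longleftrightarrow>
      integrated_prefix \<Lambda>s 1 \<or> integrated_prefix \<Lambda>s 2 \<or> integrated_prefix \<Lambda>s 3 \<or>
      integrated_prefix \<Lambda>s 4 \<or> integrated_prefix \<Lambda>s 5"
    if "length \<Lambda>s = 5" for \<Lambda>s
  proof -
    have "k \<in> {1, 2, 3, 4, 5}" if "integrated_prefix \<Lambda>s k" for k
      using that \<open>length \<Lambda>s = 5\<close> unfolding integrated_prefix_def by auto
    then show ?thesis by blast
  qed
  have integrates: "integrates_space W (walsh_level k) \<longleftrightarrow> k = 0 \<or> balanced W k" for k
    using integrates_walsh_level_0[OF assms] integrates_walsh_level_iff_balanced[OF assms, of k]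
    by (cases "k = 0") simp_all
  have takes: "take 1 [a, b, c, d, e] = [a]" "take 2 [a, b, c, d, e] = [a, b]"
      "take 3 [a, b, c, d, e] = [a, b, c]" "take 4 [a, b, c, d, e] = [a, b, c, d]"
      "take 5 [a, b, c, d, e] = [a, b, c, d, e]" for a b c d e :: "(real ^ (2 ^ 4)) set"
    by simp_all
  have prefix_levels: "integrated_prefix (map walsh_level [0, 4, i, j, 2]) 1 \<longleftrightarrow> r = card W"
      "integrated_prefix (map walsh_level [0, 4, i, j, 2]) 2 \<longleftrightarrow> r = card W / 2 \<and> balanced W 4"
      "integrated_prefix (map walsh_level [0, 4, i, j, 2]) 3 \<longleftrightarrow> r = card W / 6 \<and> balanced W 4 \<and> balanced W i"
      "integrated_prefix (map walsh_level [0, 4, i, j, 2]) 4 \<longleftrightarrow>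
        r = card W / 10 \<and> balanced W 4 \<and> balanced W i \<and> balanced W j"
      "integrated_prefix (map walsh_level [0, 4, i, j, 2]) 5 \<longleftrightarrow>
        r = card W / 16 \<and> balanced W 4 \<and> balanced W i \<and> balanced W j \<and> balanced W 2"
    if "i = 1 \<and> j = 3 \<or> i = 3 \<and> j = 1" for i j
    \<comment> \<open>Level 1 must stay the numeral \<open>1\<close> to match the dimension formulas.\<close>
    using that unfolding integrated_prefix_def list.map takes
    by (elim disjE conjE; simp add: dim_walsh_level_4 integrates del: One_nat_def)+
  have some_prefix: "(\<exists>k. integrated_prefix (map walsh_level [0, 4, i, j, 2]) k) \<longleftrightarrow>
      r = card W \<or>
      r = card W / 2 \<and> balanced W 4 \<or>
      r = card W / 6 \<and> balanced W 4 \<and> balanced W i \<or>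
      r = card W / 10 \<and> balanced W 4 \<and> balanced W i \<and> balanced W j \<or>
      r = card W / 16 \<and> balanced W 4 \<and> balanced W i \<and> balanced W j \<and> balanced W 2"
    if "i = 1 \<and> j = 3 \<or> i = 3 \<and> j = 1" for i j
  proof -
    have "length (map walsh_level [0, 4, i, j, 2] :: (real ^ (2 ^ 4)) set list) = 5" by simp
    then show ?thesis
      unfolding prefix_levels[OF that, symmetric] by (rule prefixes)
  qed
  have "r \<in> efficacy_ratios cube_graph W \<longleftrightarrow>
      (\<exists>\<Lambda>s. frequency_ordering cube_graph \<Lambda>s \<and> (\<exists>k. integrated_prefix \<Lambda>s k))"
    unfolding efficacy_ratios_def integrated_prefix_def mem_Collect_eq by blast
  also have "\<dots> \<longleftrightarrow>
      (\<exists>k. integrated_prefix (map walsh_level [0, 4, 1, 3, 2]) k) \<or>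
      (\<exists>k. integrated_prefix (map walsh_level [0, 4, 3, 1, 2]) k)"
    unfolding frequency_ordering_cube_graph_4 by blast
  also have "\<dots> \<longleftrightarrow>
    r = card W \<or>
    r = card W / 2 \<and> balanced W 4 \<or>
    r = card W / 6 \<and> balanced W 4 \<and> (balanced W 1 \<or> balanced W 3) \<or>
    r = card W / 10 \<and> balanced W 4 \<and> balanced W 1 \<and> balanced W 3 \<or>
    r = card W / 16 \<and> balanced W 4 \<and> balanced W 1 \<and> balanced W 3 \<and> balanced W 2"
    unfolding some_prefix[of 1 3, OF disjI1, OF conjI, OF refl refl]
      some_prefix[of 3 1, OF disjI2, OF conjI, OF refl refl] by argo
  finally show ?thesis .
qed

text \<open>
  The denominators 1, 2, 6 and 16 give at least 1, 1/2, 4/6 and exactly 1, so 2/5 can only be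
  undercut or attained with denominator 10, and there \<open>W\<close> has at least 4 elements.
\<close>

lemma efficacy_ratio_bounds:
  fixes W :: "(2 ^ 4) set"
  assumes "W \<noteq> {}" "r \<in> efficacy_ratios cube_graph W"
  shows "r \<ge> 2 / 5" and "r = 2 / 5 \<Longrightarrow> balanced W 1 \<and> balanced W 3 \<and> balanced W 4"
proof -
  have pos: "real (card W) \<ge> 1"
    using \<open>W \<noteq> {}\<close> by (simp add: Suc_le_eq card_gt_0_iff)
  have ge4: "real (card W) \<ge> 4" if "balanced W 4" "balanced W 1 \<or> balanced W 3"
    using card_ge_4_of_balanced[of W] that \<open>W \<noteq> {}\<close> by simp
  have all: "real (card W) = 16" if "balanced W 4" "balanced W 1" "balanced W 3" "balanced W 2"
  proof -
    have "W = UNIV"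
    proof (rule balanced_all_imp_UNIV[OF \<open>W \<noteq> {}\<close>])
      fix k :: nat
      assume "0 < k" "k \<le> CARD(4)"
      then have "k \<in> {1, 2, 3, 4}" by auto
      then show "balanced W k" using that by auto
    qed
    then show ?thesis by simp
  qed
  from assms(2)[unfolded efficacy_ratios_cube_graph_4[OF \<open>W \<noteq> {}\<close>]]
  have "r \<ge> 2 / 5 \<and> (r = 2 / 5 \<longrightarrow> balanced W 1 \<and> balanced W 3 \<and> balanced W 4)"
    by (elim disjE) (use pos ge4 all in auto)
  then show "r \<ge> 2 / 5" and "r = 2 / 5 \<Longrightarrow> balanced W 1 \<and> balanced W 3 \<and> balanced W 4"
    by auto
qed

text \<open>Finiteness is what makes the \<open>Min\<close> in \<open>efficacy\<close> a member of the set and a lower bound.\<close>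

lemma efficacy_in_ratios:
  fixes W :: "(2 ^ 4) set"
  assumes "W \<noteq> {}"
  shows "finite (efficacy_ratios cube_graph W)" and "efficacy cube_graph W \<in> efficacy_ratios cube_graph W"
proof -
  have "efficacy_ratios cube_graph W
      \<subseteq> {real (card W), card W / 2, card W / 6, card W / 10, card W / 16}"
    by (auto simp: efficacy_ratios_cube_graph_4[OF assms])
  then show fin: "finite (efficacy_ratios cube_graph W)"
    by (rule finite_subset) simp
  have "real (card W) \<in> efficacy_ratios cube_graph W"
    by (simp add: efficacy_ratios_cube_graph_4[OF assms])
  then show "efficacy cube_graph W \<in> efficacy_ratios cube_graph W"
    using Min_in[OF fin] unfolding efficacy_def efficacy_ratios_def[symmetric] by auto
qed

section \<open>The lifted Hamming code\<close>

lemma vector_4: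
  fixes a b c d :: "'a::zero"
  shows "(vector [a, b, c, d] :: 'a ^ 4) $ 1 = a" "(vector [a, b, c, d] :: 'a ^ 4) $ 2 = b"
    "(vector [a, b, c, d] :: 'a ^ 4) $ 3 = c" "(vector [a, b, c, d] :: 'a ^ 4) $ 4 = d"
  by (simp_all add: vector_def)

lemma vector_4_eq_iff:
  fixes a b c d :: "'a::zero"
  shows "(vector [a, b, c, d] :: 'a ^ 4) = vector [a', b', c', d'] \<longleftrightarrow> a = a' \<and> b = b' \<and> c = c' \<and> d = d'"
  unfolding vec_eq_iff forall_4 vector_4 by (rule refl)

lemma antipode_vector_4:
  fixes a b c d :: 2
  shows "vector [a, b, c, d] + 1 = (vector [a + 1, b + 1, c + 1, d + 1] :: 2 ^ 4)"
  unfolding vec_eq_iff forall_4 vector_add_component one_index vector_4 by (simp only: simp_thms)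

lemma walsh_UNIV_vector_4:
  "walsh UNIV $ (vector [a, b, c, d] :: 2 ^ 4) = bit_sign a * bit_sign b * bit_sign c * bit_sign d"
proof -
  have "(\<Prod>i\<in>UNIV. f i) = f 1 * f 2 * f 3 * f 4" for f :: "4 \<Rightarrow> real"
    unfolding UNIV_4 by (simp add: ac_simps)
  then show ?thesis
    unfolding walsh_def by (simp only: vec_lambda_beta vector_4)
qed

lemma card_lifted_hamming: "card lifted_hamming = 4"
  by (simp add: lifted_hamming_def vector_4_eq_iff)

lemma lifted_hamming_antipodal: "x + 1 \<in> lifted_hamming \<longleftrightarrow> x \<in> lifted_hamming"
proof -
  have "x + 1 \<in> lifted_hamming" if "x \<in> lifted_hamming" for x
    using that unfolding lifted_hamming_def
    by (elim insertE emptyE) (simp_all add: antipode_vector_4)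
  from this[of x] this[of "x + 1"] show ?thesis by auto
qed

lemma lifted_hamming_balanced_4: "balanced lifted_hamming 4"
proof -
  have "(\<Sum>w\<in>lifted_hamming. walsh UNIV $ w) = 0"
    by (simp add: lifted_hamming_def vector_4_eq_iff walsh_UNIV_vector_4)
  moreover have "S = UNIV" if "card S = 4" for S :: "4 set"
    using that card_subset_eq[of UNIV S] by simp
  ultimately show ?thesis
    unfolding balanced_def by blast
qed

lemma efficacy_lifted_hamming_le: "efficacy cube_graph lifted_hamming \<le> 2 / 5"
proof -
  have ne: "lifted_hamming \<noteq> {}" by (simp add: lifted_hamming_def)
  have "balanced lifted_hamming 1" "balanced lifted_hamming 3"
    using odd_balanced_iff_antipodal[of lifted_hamming] lifted_hamming_antipodal by auto
  then have "2 / 5 \<in> efficacy_ratios cube_graph lifted_hamming"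
    using lifted_hamming_balanced_4
    by (simp add: efficacy_ratios_cube_graph_4[OF ne] card_lifted_hamming)
  then show ?thesis
    unfolding efficacy_def efficacy_ratios_def[symmetric]
    by (rule Min_le[OF efficacy_in_ratios(1)[OF ne]])
qed

theorem theorem5p12:
  shows "optimal_design (cube_graph :: 2 ^ 4 \<Rightarrow> 2 ^ 4 \<Rightarrow> bool) lifted_hamming \<and>
    (\<forall>W. optimal_design (cube_graph :: 2 ^ 4 \<Rightarrow> 2 ^ 4 \<Rightarrow> bool) W \<longrightarrow>
      \<not> stable_set (cube_graph :: 2 ^ 4 \<Rightarrow> 2 ^ 4 \<Rightarrow> bool) W)"
proof (intro conjI allI impI)
  have ne: "lifted_hamming \<noteq> {}" by (simp add: lifted_hamming_def)
  show "optimal_design cube_graph lifted_hamming"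
    unfolding optimal_design_def
    using ne efficacy_lifted_hamming_le efficacy_ratio_bounds(1) efficacy_in_ratios(2)
    by (meson order_trans)
  fix W :: "(2 ^ 4) set"
  assume "optimal_design cube_graph W"
  then have W: "W \<noteq> {}" "efficacy cube_graph W \<le> 2 / 5"
    using ne efficacy_lifted_hamming_le unfolding optimal_design_def by (auto intro: order_trans)
  note ratio = efficacy_in_ratios(2)[OF W(1)]
  have "efficacy cube_graph W = 2 / 5"
    using W(2) efficacy_ratio_bounds(1)[OF W(1) ratio] by simp
  then show "\<not> stable_set cube_graph W"
    using efficacy_ratio_bounds(2)[OF W(1) ratio] not_stable_of_balanced[OF W(1)] by simp
qed

end
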